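(* Let $X\subseteq S\subset\mathcal{X}$ with $X$ finite, let $w:\mathcal{X}\times\mathcal{X}\to[0,1]$, and let $Z_T$ be a $p^2$-weighted multi-resolution hashing-based estimator built from hashing schemes $\mathcal{H}_1,\dots,\mathcal{H}_T$ with collision probabilities $p_1,\dots,p_T$. Let $p_*(x,y):=\sup_{t\in[T]}p_t(x,y)$. Then for every query $y\in\mathcal{X}$ with $\mu:=\frac{1}{|X|}\sum_{x\in X}w(x,y)>0$, writing for $x_1,x_2\in S$: $f_i:=\min\{1,\mu/w(x_i,y)\}$, $$\mathbb{E}[Z_T^2(y)]\le\mu^2+4\sup_{x_1,x_2\in S}\Big\{f_1^2\frac{w^2(x_1,y)}{p_*(x_1,y)}+f_2^2\frac{w^2(x_2,y)}{p_*(x_2,y)}+f_1f_2\Big(\frac{w^2(x_1,y)}{p_*^2(x_1,y)}+\frac{w^2(x_2,y)}{p_*^2(x_2,y)}\Big)D_T(x_1,x_2)\Big\},$$ where $D_T(x_1,x_2):=\max_{t\in[T]}\min\{p_t(x_1,y),p_t(x_2,y)\}$, and moreover $D_T(x_1,x_2)\le\min\{p_*(x_1,y),p_*(x_2,y)\}$.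
   Context: A hashing scheme $\mathcal{H}$ on a set $\mathcal{X}$ is a probability distribution over pairs $(h,g)$ of functions $\mathcal{X}\to\mathcal{U}$; its collision probability is $p(x,y)=\mathbb{P}_{(h,g)\sim\mathcal{H}}[h(x)=g(y)]$. For a sampled pair and $y\in\mathcal{X}$, the hash bucket is $H(y)=\{x\in X: h(x)=g(y)\}$. Given hashing schemes $\mathcal{H}_1,\dots,\mathcal{H}_T$ with collision probabilities $p_1,\dots,p_T$ and functions $w_t:\mathcal{X}\times\mathcal{X}\to\mathbb{R}_{\ge0}$, the multi-resolution hashing-based estimator is obtained by independently sampling $(h_t,g_t)\sim\mathcal{H}_t$ for each $t$; given $y$, let $X_t$ be a uniformly random element of $H_t(y)$ (or $\perp$ if $H_t(y)=\emptyset$) and set $Z_T(y)=\frac{1}{|X|}\sum_{t=1}^T\frac{w_t(X_t,y)}{p_t(X_t,y)}|H_t(y)|$, where a term with $X_t=\perp$ is $0$. It is $p^2$-weighted (for $w$) if $w_t(x,y)=\frac{p_t^2(x,y)}{W(x,y)}w(x,y)$ with $W(x,y)=\sum_{t:\,p_t(x,y)>0}p_t^2(x,y)$, and it is assumed unbiased, i.e. whenever $w(x,y)>0$ there is some $t$ with $p_t(x,y)>0$. *)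

theory Defs
  imports "HOL-Probability.Probability"
begin

text \<open>
  The ground set is the type \<open>'x\<close> and the set of hash values is the type \<open>'u\<close>. A hashing scheme
  is an arbitrary (not necessarily discrete) probability measure on pairs of hash functions; the
  collision events have to be measurable for collision probabilities to make sense.
\<close>

type_synonym ('x, 'u) hash_pair = "('x \<Rightarrow> 'u) \<times> ('x \<Rightarrow> 'u)"

definition hashing_scheme :: "('x, 'u) hash_pair measure \<Rightarrow> bool" where
  "hashing_scheme H \<longleftrightarrow>
     prob_space H \<and> (\<forall>x y. {hg \<in> space H. fst hg x = snd hg y} \<in> sets H)"

definition collision_prob :: "('x, 'u) hash_pair measure \<Rightarrow> 'x \<Rightarrow> 'x \<Rightarrow> real" where
  "collision_prob H x y = measure H {hg \<in> space H. fst hg x = snd hg y}"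

definition hash_bucket :: "'x set \<Rightarrow> ('x, 'u) hash_pair \<Rightarrow> 'x \<Rightarrow> 'x set" where
  "hash_bucket X hg y = {x \<in> X. fst hg x = snd hg y}"

text \<open>The value \<open>None\<close> plays the role of \<open>\<bottom>\<close>.\<close>

definition uniform_or_bot :: "'x set \<Rightarrow> 'x option pmf" where
  "uniform_or_bot B = (if B = {} then return_pmf None else map_pmf Some (pmf_of_set B))"

text \<open>Joint law of a sampled pair \<open>(h, g)\<close> and of the point drawn from its bucket at \<open>y\<close>.\<close>

definition bucket_sample ::
  "'x set \<Rightarrow> 'x \<Rightarrow> ('x, 'u) hash_pair measure \<Rightarrow> (('x, 'u) hash_pair \<times> 'x option) measure" where
  "bucket_sample X y H =
     H \<bind> (\<lambda>hg. measure_pmf (uniform_or_bot (hash_bucket X hg y)) \<bind>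
       (\<lambda>c. return (H \<Otimes>\<^sub>M count_space UNIV) (hg, c)))"

text \<open>
  The product measure expresses that the \<open>T\<close> rounds, including the draws from the buckets, are
  independent.
\<close>

definition mrhbe_space ::
  "'x set \<Rightarrow> nat \<Rightarrow> (nat \<Rightarrow> ('x, 'u) hash_pair measure) \<Rightarrow> 'x \<Rightarrow>
     (nat \<Rightarrow> ('x, 'u) hash_pair \<times> 'x option) measure" where
  "mrhbe_space X T H y = PiM {1..T} (\<lambda>t. bucket_sample X y (H t))"

definition mrhbe ::
  "'x set \<Rightarrow> nat \<Rightarrow> (nat \<Rightarrow> ('x, 'u) hash_pair measure) \<Rightarrow> (nat \<Rightarrow> 'x \<Rightarrow> 'x \<Rightarrow> real) \<Rightarrow> 'x \<Rightarrow>
     (nat \<Rightarrow> ('x, 'u) hash_pair \<times> 'x option) \<Rightarrow> real" where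
  "mrhbe X T H ws y \<omega> = 1 / real (card X) * (\<Sum>t=1..T.
     (case snd (\<omega> t) of
        None \<Rightarrow> 0
      | Some x \<Rightarrow> ws t x y / collision_prob (H t) x y * real (card (hash_bucket X (fst (\<omega> t)) y))))"

definition p2_total :: "nat \<Rightarrow> (nat \<Rightarrow> ('x, 'u) hash_pair measure) \<Rightarrow> 'x \<Rightarrow> 'x \<Rightarrow> real" where
  "p2_total T H x y =
     (\<Sum>t | t \<in> {1..T} \<and> collision_prob (H t) x y > 0. (collision_prob (H t) x y)\<^sup>2)"

text \<open>
  Where all collision probabilities vanish, the quotient below is \<open>0 / 0 = 0\<close>, so that the weights
  are \<open>0\<close> there.
\<close>

definition p2_weighted ::
  "nat \<Rightarrow> (nat \<Rightarrow> ('x, 'u) hash_pair measure) \<Rightarrow> (nat \<Rightarrow> 'x \<Rightarrow> 'x \<Rightarrow> real) \<Rightarrow>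
     ('x \<Rightarrow> 'x \<Rightarrow> real) \<Rightarrow> bool" where
  "p2_weighted T H ws w \<longleftrightarrow>
     (\<forall>t\<in>{1..T}. \<forall>x y. ws t x y = (collision_prob (H t) x y)\<^sup>2 / p2_total T H x y * w x y)"

text \<open>The standing condition under which a \<open>p\<^sup>2\<close>-weighted estimator is unbiased.\<close>

definition covers_support ::
  "nat \<Rightarrow> (nat \<Rightarrow> ('x, 'u) hash_pair measure) \<Rightarrow> ('x \<Rightarrow> 'x \<Rightarrow> real) \<Rightarrow> bool" where
  "covers_support T H w \<longleftrightarrow>
     (\<forall>x y. w x y > 0 \<longrightarrow> (\<exists>t\<in>{1..T}. collision_prob (H t) x y > 0))"

definition p_star :: "nat \<Rightarrow> (nat \<Rightarrow> ('x, 'u) hash_pair measure) \<Rightarrow> 'x \<Rightarrow> 'x \<Rightarrow> real" where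
  "p_star T H x y = (SUP t\<in>{1..T}. collision_prob (H t) x y)"

definition D_max :: "nat \<Rightarrow> (nat \<Rightarrow> ('x, 'u) hash_pair measure) \<Rightarrow> 'x \<Rightarrow> 'x \<Rightarrow> 'x \<Rightarrow> real" where
  "D_max T H y x1 x2 = (MAX t\<in>{1..T}. min (collision_prob (H t) x1 y) (collision_prob (H t) x2 y))"

definition mean_weight :: "'x set \<Rightarrow> ('x \<Rightarrow> 'x \<Rightarrow> real) \<Rightarrow> 'x \<Rightarrow> real" where
  "mean_weight X w y = 1 / real (card X) * (\<Sum>x\<in>X. w x y)"

text \<open>
  \<open>min {1, \<mu> / v}\<close> for \<open>\<mu> > 0\<close>, where \<open>\<mu> / 0\<close> has to be read as \<open>\<infinity>\<close> (HOL's \<open>\<mu> / 0 = 0\<close> would give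
  the value \<open>0\<close> instead of \<open>1\<close>).
\<close>

definition clip_ratio :: "real \<Rightarrow> real \<Rightarrow> real" where
  "clip_ratio \<mu> v = (if v = 0 then 1 else min 1 (\<mu> / v))"

lemma measurable_hash_bucket:
  assumes "hashing_scheme H" and "finite X"
  shows "(\<lambda>hg. hash_bucket X hg y) \<in> H \<rightarrow>\<^sub>M count_space (Pow X)"
proof (rule measurable_count_space_eq2[THEN iffD2])
  show "finite (Pow X)" using assms by simp
  have 1: "(\<lambda>hg. hash_bucket X hg y) -` {B} \<inter> space H \<in> sets H" if "B \<subseteq> X" for B
  proof -
    have "(\<lambda>hg. hash_bucket X hg y) -` {B} \<inter> space H =
        {hg \<in> space H. \<forall>x\<in>X. (fst hg x = snd hg y) = (x \<in> B)}"
      using that by (auto simp: hash_bucket_def)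
    also have "\<dots> \<in> sets H"
    proof (rule sets.sets_Collect_finite_All)
      fix x assume "x \<in> X"
      have "{hg \<in> space H. fst hg x = snd hg y} \<in> sets H"
        using assms by (auto simp: hashing_scheme_def)
      then show "{hg \<in> space H. (fst hg x = snd hg y) = (x \<in> B)} \<in> sets H"
        by (cases "x \<in> B") (auto intro: sets.sets_Collect_neg)
    qed (use assms in auto)
    finally show ?thesis .
  qed
  then show "(\<lambda>hg. hash_bucket X hg y) \<in> space H \<rightarrow> Pow X \<and>
      (\<forall>B\<in>Pow X. (\<lambda>hg. hash_bucket X hg y) -` {B} \<inter> space H \<in> sets H)"
    by (auto simp: hash_bucket_def)
qed

lemma measurable_bucket_kernel:
  assumes "hashing_scheme H" and "finite X"
  shows "(\<lambda>hg. measure_pmf (uniform_or_bot (hash_bucket X hg y)) \<bind>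
       (\<lambda>c. return (H \<Otimes>\<^sub>M count_space UNIV) (hg, c)))
     \<in> H \<rightarrow>\<^sub>M prob_algebra (H \<Otimes>\<^sub>M count_space UNIV)"
proof (rule measurable_bind_prob_space2)
  have "(\<lambda>B. measure_pmf (uniform_or_bot B)) \<in> count_space (Pow X) \<rightarrow>\<^sub>M prob_algebra (count_space UNIV)"
    by (auto simp: space_prob_algebra measure_pmf.prob_space_axioms)
  from measurable_compose[OF measurable_hash_bucket[OF assms] this]
  show "(\<lambda>hg. measure_pmf (uniform_or_bot (hash_bucket X hg y)))
      \<in> H \<rightarrow>\<^sub>M prob_algebra (count_space UNIV)" .
qed simp

lemma
  assumes "hashing_scheme H" and "finite X"
  shows prob_space_bucket_sample: "prob_space (bucket_sample X y H)"
    and sets_bucket_sample: "sets (bucket_sample X y H) = sets (H \<Otimes>\<^sub>M count_space UNIV)"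
proof -
  have "H \<in> space (prob_algebra H)"
    using assms by (auto simp: space_prob_algebra hashing_scheme_def)
  from prob_space_bind'[OF this measurable_bucket_kernel[OF assms]]
    sets_bind'[OF this measurable_bucket_kernel[OF assms]]
  show "prob_space (bucket_sample X y H)"
    and "sets (bucket_sample X y H) = sets (H \<Otimes>\<^sub>M count_space UNIV)"
    unfolding bucket_sample_def by auto
qed

lemma prob_space_mrhbe_space:
  assumes "\<And>t. t \<in> {1..T} \<Longrightarrow> hashing_scheme (H t)" and "finite X"
  shows "prob_space (mrhbe_space X T H y)"
  unfolding mrhbe_space_def
  using assms by (intro prob_space_PiM prob_space_bucket_sample) auto

lemma borel_measurable_mrhbe:
  assumes "\<And>t. t \<in> {1..T} \<Longrightarrow> hashing_scheme (H t)" and "finite X"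
  shows "mrhbe X T H ws y \<in> borel_measurable (mrhbe_space X T H y)"
proof -
  have *: "(\<lambda>\<omega>. case snd (\<omega> t) of None \<Rightarrow> 0
      | Some x \<Rightarrow> ws t x y / collision_prob (H t) x y * real (card (hash_bucket X (fst (\<omega> t)) y)))
      \<in> borel_measurable (mrhbe_space X T H y)" if t: "t \<in> {1..T}" for t
  proof -
    have "(\<lambda>\<omega>. \<omega> t) \<in> mrhbe_space X T H y \<rightarrow>\<^sub>M bucket_sample X y (H t)"
      unfolding mrhbe_space_def using t by (rule measurable_component_singleton)
    then have \<omega>: "(\<lambda>\<omega>. \<omega> t) \<in> mrhbe_space X T H y \<rightarrow>\<^sub>M H t \<Otimes>\<^sub>M count_space UNIV"
      using measurable_cong_sets[OF refl sets_bucket_sample[OF assms(1)[OF t] assms(2)]] by blast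
    have card: "(\<lambda>hg. real (card (hash_bucket X hg y))) \<in> borel_measurable (H t)"
      by (rule measurable_compose[OF measurable_hash_bucket[OF assms(1)[OF t] assms(2)]]) simp
    have "(\<lambda>q. case snd q of None \<Rightarrow> 0
        | Some x \<Rightarrow> ws t x y / collision_prob (H t) x y * real (card (hash_bucket X (fst q) y)))
        = (\<lambda>q. (case snd q of None \<Rightarrow> 0 | Some x \<Rightarrow> ws t x y / collision_prob (H t) x y)
            * real (card (hash_bucket X (fst q) y)))"
      by (auto split: option.split)
    also have "\<dots> \<in> borel_measurable (H t \<Otimes>\<^sub>M count_space UNIV)"
      by (intro borel_measurable_times measurable_compose[OF measurable_fst card]
            measurable_compose[OF measurable_snd]) simp
    finally show ?thesis by (rule measurable_compose[OF \<omega>])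
  qed
  show ?thesis
    unfolding mrhbe_def by (intro borel_measurable_times borel_measurable_sum * borel_measurable_const)
qed

end

theory Submission
  imports Defs
begin

text \<open>
  Since the rounds are independent, the second moment of a sum of nonnegative rounds is at most the
  square of its mean plus the sum of the second moments. Given the bucket of a round, its squared
  contribution averages to a double sum over the bucket, and two points \<open>x\<close>, \<open>x'\<close> lie in the bucket
  of round \<open>t\<close> together with probability at most \<open>min (p\<^sub>t x) (p\<^sub>t x')\<close>. With \<open>p\<^sup>2\<close>-weights, summing over
  \<open>t\<close> bounds the variance by \<open>n\<^sup>-\<^sup>2 \<Sum>x x'. w(x)\<^sup>2 / p\<^sub>*(x)\<^sup>2 D(x, x')\<close>. Finally, \<open>1 / f = max 1 (w / \<mu>)\<close> is at most
  \<open>1 + w / \<mu>\<close>, whose average over \<open>X\<close> is \<open>2\<close>; pulling the factors \<open>1 / f(x)\<close> and \<open>1 / f(x')\<close> out of the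
  double sum therefore costs the factor \<open>4\<close>.
\<close>

section \<open>Moments of sums of independent coordinates\<close>

lemma nn_integral_PiM_component:
  assumes "\<And>i. i \<in> I \<Longrightarrow> prob_space (M i)" and "i \<in> I" and "f \<in> borel_measurable (M i)"
  shows "(\<integral>\<^sup>+\<omega>. f (\<omega> i) \<partial>PiM I M) = (\<integral>\<^sup>+x. f x \<partial>M i)"
proof -
  have "(\<integral>\<^sup>+x. f x \<partial>distr (PiM I M) (M i) (\<lambda>\<omega>. \<omega> i)) = (\<integral>\<^sup>+\<omega>. f (\<omega> i) \<partial>PiM I M)"
    using assms by (intro nn_integral_distr) auto
  then show ?thesis using distr_PiM_component[of I M i] assms by simp
qed

text \<open>The product formula is applied to the family that is \<open>f\<close> at
  \<open>i\<close>, \<open>g\<close> at \<open>j\<close> and constantly 1 elsewhere; the constant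
  factors integrate to 1 over probability measures.\<close>

lemma nn_integral_PiM_times:
  fixes M :: "'i \<Rightarrow> 'a measure" and f g :: "'a \<Rightarrow> ennreal"
  assumes I: "finite I" and M: "\<And>i. i \<in> I \<Longrightarrow> prob_space (M i)"
    and ij: "i \<in> I" "j \<in> I" "i \<noteq> j"
    and f: "f \<in> borel_measurable (M i)" and g: "g \<in> borel_measurable (M j)"
  shows "(\<integral>\<^sup>+\<omega>. f (\<omega> i) * g (\<omega> j) \<partial>PiM I M) = (\<integral>\<^sup>+x. f x \<partial>M i) * (\<integral>\<^sup>+x. g x \<partial>M j)"
proof -
  \<comment> \<open>The product formula lives in a locale that asks for sigma-finiteness at every
    index, so outside \<open>I\<close> the family is filled up with a point mass; the product over
    \<open>I\<close> stays the same.\<close>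
  define M' where "M' k = (if k \<in> I then M k else return (count_space UNIV) undefined)" for k
  have prob: "prob_space (M' k)" for k
    by (auto simp: M'_def M intro: prob_space_return)
  interpret product_sigma_finite M'
    by (intro product_sigma_finite.intro prob_space_imp_sigma_finite prob)
  define F where "F k = (if k = i then f else if k = j then g else (\<lambda>_. 1))" for k
  have split: "(\<Prod>k\<in>I. h k) = h i * h j" if "\<And>k. k \<in> I \<Longrightarrow> k \<noteq> i \<Longrightarrow> k \<noteq> j \<Longrightarrow> h k = 1"
    for h :: "'i \<Rightarrow> ennreal"
  proof -
    have "prod h I = prod h {i, j}"
      using I ij that by (intro prod.mono_neutral_right) auto
    then show ?thesis using ij by simp
  qed
  have "PiM I M = PiM I M'"
    by (intro PiM_cong) (auto simp: M'_def)
  moreover have "(\<integral>\<^sup>+\<omega>. (\<Prod>k\<in>I. F k (\<omega> k)) \<partial>PiM I M') = (\<Prod>k\<in>I. \<integral>\<^sup>+x. F k x \<partial>M' k)"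
    using I f g ij by (intro product_nn_integral_prod) (auto simp: F_def M'_def)
  moreover have "(\<Prod>k\<in>I. F k (\<omega> k)) = f (\<omega> i) * g (\<omega> j)" for \<omega>
    using ij by (subst split) (auto simp: F_def)
  moreover have "(\<Prod>k\<in>I. \<integral>\<^sup>+x. F k x \<partial>M' k) = (\<integral>\<^sup>+x. f x \<partial>M i) * (\<integral>\<^sup>+x. g x \<partial>M j)"
    using ij by (subst split) (auto simp: F_def M'_def prob_space.emeasure_space_1 M)
  ultimately show ?thesis by simp
qed

text \<open>Expanding the square, the off-diagonal products factorise by independence and the
  diagonal yields the second moments. Stated as an upper bound without the negative squared means,
  it needs no subtraction in \<open>ennreal\<close>.\<close>

lemma nn_integral_PiM_sum_square_le:
  fixes f :: "'i \<Rightarrow> 'a \<Rightarrow> ennreal"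
  assumes I: "finite I" and M: "\<And>i. i \<in> I \<Longrightarrow> prob_space (M i)"
    and f: "\<And>i. i \<in> I \<Longrightarrow> f i \<in> borel_measurable (M i)"
  shows "(\<integral>\<^sup>+\<omega>. (\<Sum>i\<in>I. f i (\<omega> i))\<^sup>2 \<partial>PiM I M)
    \<le> (\<Sum>i\<in>I. \<integral>\<^sup>+x. f i x \<partial>M i)\<^sup>2 + (\<Sum>i\<in>I. \<integral>\<^sup>+x. (f i x)\<^sup>2 \<partial>M i)"
proof -
  let ?e = "\<lambda>i. \<integral>\<^sup>+x. f i x \<partial>M i"
  have meas [measurable]: "(\<lambda>\<omega>. f i (\<omega> i)) \<in> borel_measurable (PiM I M)" if "i \<in> I" for i
    using that f by (intro measurable_compose[OF measurable_component_singleton]) auto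
  have "(\<integral>\<^sup>+\<omega>. (\<Sum>i\<in>I. f i (\<omega> i))\<^sup>2 \<partial>PiM I M)
      = (\<integral>\<^sup>+\<omega>. (\<Sum>i\<in>I. \<Sum>j\<in>I. f i (\<omega> i) * f j (\<omega> j)) \<partial>PiM I M)"
    by (simp add: power2_eq_square sum_product)
  also have "\<dots> = (\<Sum>i\<in>I. \<Sum>j\<in>I. \<integral>\<^sup>+\<omega>. f i (\<omega> i) * f j (\<omega> j) \<partial>PiM I M)"
    by (simp add: nn_integral_sum)
  \<comment> \<open>Each diagonal term receives the extra summand \<open>?e i * ?e i\<close>, which
    completes the double sum to the square of the total mean.\<close>
  also have "\<dots> \<le> (\<Sum>i\<in>I. \<Sum>j\<in>I. ?e i * ?e j + (if i = j then \<integral>\<^sup>+x. (f i x)\<^sup>2 \<partial>M i else 0))"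
  proof (intro sum_mono)
    fix i j assume ij: "i \<in> I" "j \<in> I"
    show "(\<integral>\<^sup>+\<omega>. f i (\<omega> i) * f j (\<omega> j) \<partial>PiM I M)
        \<le> ?e i * ?e j + (if i = j then \<integral>\<^sup>+x. (f i x)\<^sup>2 \<partial>M i else 0)"
    proof (cases "i = j")
      case True
      have "(\<integral>\<^sup>+\<omega>. (f i (\<omega> i))\<^sup>2 \<partial>PiM I M) = (\<integral>\<^sup>+x. (f i x)\<^sup>2 \<partial>M i)"
        using ij f M by (intro nn_integral_PiM_component[where f = "\<lambda>x. (f i x)\<^sup>2"]) auto
      then show ?thesis using True by (simp add: power2_eq_square)
    next
      case False
      then show ?thesis
        using ij f M I by (subst nn_integral_PiM_times) auto
    qed
  qed
  also have "\<dots> = (\<Sum>i\<in>I. ?e i)\<^sup>2 + (\<Sum>i\<in>I. \<integral>\<^sup>+x. (f i x)\<^sup>2 \<partial>M i)"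
    using I by (simp add: sum.distrib power2_eq_square sum_product)
  finally show ?thesis .
qed

section \<open>First and second moment of a single round\<close>

text \<open>Integrating the inner kernel first, the uniform law turns into an average over the
  bucket. With \<open>bot\<close>, an empty bucket contributes 0, in agreement with
  \<open>0 / 0 = 0\<close> on the right.\<close>

lemma nn_integral_bucket_sample:
  assumes H: "hashing_scheme H" and X: "finite X"
    and F: "F \<in> borel_measurable (H \<Otimes>\<^sub>M count_space UNIV)"
    and bot: "\<And>hg. F (hg, None) = 0"
  shows "(\<integral>\<^sup>+q. F q \<partial>bucket_sample X y H)
    = (\<integral>\<^sup>+hg. (\<Sum>x\<in>hash_bucket X hg y. F (hg, Some x)) / card (hash_bucket X hg y) \<partial>H)"
proof -
  have "(\<integral>\<^sup>+q. F q \<partial>bucket_sample X y H)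
     = (\<integral>\<^sup>+hg. \<integral>\<^sup>+q. F q \<partial>(measure_pmf (uniform_or_bot (hash_bucket X hg y)) \<bind>
         (\<lambda>c. return (H \<Otimes>\<^sub>M count_space UNIV) (hg, c))) \<partial>H)"
    unfolding bucket_sample_def
    by (intro nn_integral_bind[OF F] measurable_prob_algebraD measurable_bucket_kernel assms)
  also have "\<dots> = (\<integral>\<^sup>+hg. (\<Sum>x\<in>hash_bucket X hg y. F (hg, Some x)) / card (hash_bucket X hg y) \<partial>H)"
  proof (intro nn_integral_cong)
    fix hg assume hg: "hg \<in> space H"
    let ?B = "hash_bucket X hg y"
    have "(\<lambda>c. return (H \<Otimes>\<^sub>M count_space UNIV) (hg, c))
        \<in> measure_pmf (uniform_or_bot ?B) \<rightarrow>\<^sub>M subprob_algebra (H \<Otimes>\<^sub>M count_space UNIV)"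
      using hg by (intro measurable_compose[OF _ return_measurable]) (auto simp: space_pair_measure)
    then have "(\<integral>\<^sup>+q. F q \<partial>(measure_pmf (uniform_or_bot ?B) \<bind>
         (\<lambda>c. return (H \<Otimes>\<^sub>M count_space UNIV) (hg, c))))
       = (\<integral>\<^sup>+c. \<integral>\<^sup>+q. F q \<partial>return (H \<Otimes>\<^sub>M count_space UNIV) (hg, c) \<partial>measure_pmf (uniform_or_bot ?B))"
      by (rule nn_integral_bind[OF F])
    also have "\<dots> = (\<integral>\<^sup>+c. F (hg, c) \<partial>measure_pmf (uniform_or_bot ?B))"
      using hg F by (intro nn_integral_cong nn_integral_return) (auto simp: space_pair_measure)
    also have "\<dots> = (\<Sum>x\<in>?B. F (hg, Some x)) / card ?B"
    proof (cases "?B = {}")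
      case True
      then show ?thesis by (simp add: uniform_or_bot_def bot)
    next
      case False
      moreover have "finite ?B" using X by (simp add: hash_bucket_def)
      ultimately show ?thesis by (simp add: uniform_or_bot_def nn_integral_pmf_of_set)
    qed
    finally show "(\<integral>\<^sup>+q. F q \<partial>(measure_pmf (uniform_or_bot ?B) \<bind>
         (\<lambda>c. return (H \<Otimes>\<^sub>M count_space UNIV) (hg, c)))) = (\<Sum>x\<in>?B. F (hg, Some x)) / card ?B" .
  qed
  finally show ?thesis .
qed

text \<open>The summand of one round of the estimator, without the prefactor; \<open>v\<close>
  stands for the quotient of weight and collision probability at the fixed query
  \<open>y\<close>.\<close>

definition bucket_term ::
  "'x set \<Rightarrow> 'x \<Rightarrow> ('x \<Rightarrow> real) \<Rightarrow> ('x, 'u) hash_pair \<times> 'x option \<Rightarrow> real" where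
  "bucket_term X y v q =
     (case snd q of None \<Rightarrow> 0 | Some x \<Rightarrow> v x * real (card (hash_bucket X (fst q) y)))"

lemma borel_measurable_bucket_term:
  assumes "hashing_scheme H" and "finite X"
  shows "bucket_term X y v \<in> borel_measurable (H \<Otimes>\<^sub>M count_space UNIV)"
proof -
  have card: "(\<lambda>hg. real (card (hash_bucket X hg y))) \<in> borel_measurable H"
    by (rule measurable_compose[OF measurable_hash_bucket[OF assms]]) simp
  \<comment> \<open>One factor depends only on the drawn point, which lives in a discrete space, the
    other only on the hash pair.\<close>
  have "bucket_term X y v = (\<lambda>q. (case snd q of None \<Rightarrow> 0 | Some x \<Rightarrow> v x)
      * real (card (hash_bucket X (fst q) y)))"
    by (auto simp: bucket_term_def split: option.split)
  also have "\<dots> \<in> borel_measurable (H \<Otimes>\<^sub>M count_space UNIV)"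
    by (intro borel_measurable_times measurable_compose[OF measurable_fst card]
          measurable_compose[OF measurable_snd]) simp
  finally show ?thesis .
qed

text \<open>Indicators replace the random index set by the fixed set \<open>X\<close>, so that
  integral and sum can be exchanged.\<close>

lemma sum_hash_bucket:
  fixes f :: "'x \<Rightarrow> ennreal"
  assumes "finite X" and "hg \<in> space H"
  shows "(\<Sum>x\<in>hash_bucket X hg y. f x)
    = (\<Sum>x\<in>X. f x * indicator {hg \<in> space H. fst hg x = snd hg y} hg)"
proof -
  have "(\<Sum>x\<in>hash_bucket X hg y. f x) = (\<Sum>x\<in>X. if fst hg x = snd hg y then f x else 0)"
    unfolding hash_bucket_def using assms(1) by (rule sum.inter_filter)
  also have "\<dots> = (\<Sum>x\<in>X. f x * indicator {hg \<in> space H. fst hg x = snd hg y} hg)"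
    using assms(2) by (intro sum.cong) auto
  finally show ?thesis .
qed

lemma ennreal_times_of_nat_divide:
  fixes a :: ennreal
  assumes "0 < n"
  shows "a * of_nat n / of_nat n = a"
  using assms by (intro mult_divide_eq_ennreal) auto

text \<open>The bucket size in the summand cancels the averaging over the bucket, so a point
  \<open>x\<close> contributes \<open>v x\<close> exactly when it collides with
  \<open>y\<close>.\<close>

lemma nn_integral_bucket_term:
  assumes H: "hashing_scheme H" and X: "finite X" and v: "\<And>x. 0 \<le> v x"
  shows "(\<integral>\<^sup>+q. ennreal (bucket_term X y v q) \<partial>bucket_sample X y H)
    = (\<Sum>x\<in>X. ennreal (v x * collision_prob H x y))"
proof -
  interpret prob_space H using H by (simp add: hashing_scheme_def)
  have E: "{hg \<in> space H. fst hg x = snd hg y} \<in> sets H" for x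
    using H by (simp add: hashing_scheme_def)
  note [measurable] = borel_measurable_bucket_term[OF H X]
  have "(\<integral>\<^sup>+q. ennreal (bucket_term X y v q) \<partial>bucket_sample X y H)
      = (\<integral>\<^sup>+hg. (\<Sum>x\<in>hash_bucket X hg y. ennreal (bucket_term X y v (hg, Some x)))
          / card (hash_bucket X hg y) \<partial>H)"
    by (intro nn_integral_bucket_sample[OF H X]) (measurable, simp add: bucket_term_def)
  also have "\<dots> = (\<integral>\<^sup>+hg. (\<Sum>x\<in>X. ennreal (v x)
      * indicator {hg \<in> space H. fst hg x = snd hg y} hg) \<partial>H)"
  proof (intro nn_integral_cong)
    fix hg assume hg: "hg \<in> space H"
    let ?B = "hash_bucket X hg y"
    have B: "finite ?B" using X by (simp add: hash_bucket_def)
    have "(\<Sum>x\<in>?B. ennreal (bucket_term X y v (hg, Some x))) / card ?B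
       = (\<Sum>x\<in>?B. ennreal (v x)) * of_nat (card ?B) / of_nat (card ?B)"
      unfolding sum_distrib_right
      by (simp add: bucket_term_def ennreal_mult v ennreal_of_nat_eq_real_of_nat)
    also have "\<dots> = (\<Sum>x\<in>?B. ennreal (v x))"
      using B by (cases "?B = {}") (auto intro!: ennreal_times_of_nat_divide simp: card_gt_0_iff)
    finally show "(\<Sum>x\<in>?B. ennreal (bucket_term X y v (hg, Some x))) / card ?B
       = (\<Sum>x\<in>X. ennreal (v x) * indicator {hg \<in> space H. fst hg x = snd hg y} hg)"
      by (simp only: sum_hash_bucket[OF X hg])
  qed
  also have "\<dots> = (\<Sum>x\<in>X. ennreal (v x) * emeasure H {hg \<in> space H. fst hg x = snd hg y})"
    using E by (simp add: nn_integral_sum nn_integral_cmult)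
  also have "\<dots> = (\<Sum>x\<in>X. ennreal (v x * collision_prob H x y))"
    by (simp add: collision_prob_def emeasure_eq_measure ennreal_mult v)
  finally show ?thesis .
qed

text \<open>Squaring produces two factors of the bucket size. One cancels the averaging; the other
  counts a second point \<open>x'\<close> of the bucket. The joint collision event lies in each of
  the two single events, whence the minimum.\<close>

lemma nn_integral_bucket_term_square_le:
  assumes H: "hashing_scheme H" and X: "finite X" and v: "\<And>x. 0 \<le> v x"
  shows "(\<integral>\<^sup>+q. (ennreal (bucket_term X y v q))\<^sup>2 \<partial>bucket_sample X y H)
    \<le> (\<Sum>x\<in>X. \<Sum>x'\<in>X. ennreal ((v x)\<^sup>2 * min (collision_prob H x y) (collision_prob H x' y)))"
proof -
  interpret prob_space H using H by (simp add: hashing_scheme_def)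
  let ?E = "\<lambda>x. {hg \<in> space H. fst hg x = snd hg y}"
  have E: "?E x \<in> sets H" for x
    using H by (simp add: hashing_scheme_def)
  note [measurable] = borel_measurable_bucket_term[OF H X]
  have "(\<integral>\<^sup>+q. (ennreal (bucket_term X y v q))\<^sup>2 \<partial>bucket_sample X y H)
      = (\<integral>\<^sup>+hg. (\<Sum>x\<in>hash_bucket X hg y. (ennreal (bucket_term X y v (hg, Some x)))\<^sup>2)
          / card (hash_bucket X hg y) \<partial>H)"
    by (intro nn_integral_bucket_sample[OF H X]) (measurable, simp add: bucket_term_def)
  also have "\<dots> = (\<integral>\<^sup>+hg. (\<Sum>x\<in>X. \<Sum>x'\<in>X. ennreal ((v x)\<^sup>2) * indicator (?E x \<inter> ?E x') hg) \<partial>H)"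
  proof (intro nn_integral_cong)
    fix hg assume hg: "hg \<in> space H"
    let ?B = "hash_bucket X hg y"
    have B: "finite ?B" using X by (simp add: hash_bucket_def)
    have "(\<Sum>x\<in>?B. (ennreal (bucket_term X y v (hg, Some x)))\<^sup>2) / card ?B
       = ((\<Sum>x\<in>?B. ennreal ((v x)\<^sup>2)) * of_nat (card ?B)) * of_nat (card ?B) / of_nat (card ?B)"
      unfolding sum_distrib_right
      by (simp add: bucket_term_def ennreal_mult v ennreal_of_nat_eq_real_of_nat
          power2_eq_square mult_ac)
    also have "\<dots> = (\<Sum>x\<in>?B. ennreal ((v x)\<^sup>2)) * of_nat (card ?B)"
      using B by (cases "?B = {}") (auto intro!: ennreal_times_of_nat_divide simp: card_gt_0_iff)
    \<comment> \<open>Writing the remaining bucket size as a sum of ones makes the expression a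
      double sum over pairs of bucket points.\<close>
    also have "\<dots> = (\<Sum>x\<in>?B. ennreal ((v x)\<^sup>2)) * (\<Sum>x\<in>?B. 1)"
      by simp
    also have "\<dots> = (\<Sum>x\<in>X. \<Sum>x'\<in>X. ennreal ((v x)\<^sup>2) * indicator (?E x \<inter> ?E x') hg)"
      unfolding sum_hash_bucket[OF X hg] sum_product
      by (intro sum.cong refl) (simp add: indicator_inter_arith mult_ac)
    finally show "(\<Sum>x\<in>?B. (ennreal (bucket_term X y v (hg, Some x)))\<^sup>2) / card ?B
       = (\<Sum>x\<in>X. \<Sum>x'\<in>X. ennreal ((v x)\<^sup>2) * indicator (?E x \<inter> ?E x') hg)" .
  qed
  also have "\<dots> = (\<Sum>x\<in>X. \<Sum>x'\<in>X. ennreal ((v x)\<^sup>2) * emeasure H (?E x \<inter> ?E x'))"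
    using E by (simp add: nn_integral_sum nn_integral_cmult sets.Int)
  also have "\<dots> \<le> (\<Sum>x\<in>X. \<Sum>x'\<in>X.
      ennreal ((v x)\<^sup>2 * min (collision_prob H x y) (collision_prob H x' y)))"
  proof (intro sum_mono)
    fix x x'
    have "measure H (?E x \<inter> ?E x') \<le> min (collision_prob H x y) (collision_prob H x' y)"
      using E by (auto simp: collision_prob_def intro!: finite_measure_mono)
    then show "ennreal ((v x)\<^sup>2) * emeasure H (?E x \<inter> ?E x')
      \<le> ennreal ((v x)\<^sup>2 * min (collision_prob H x y) (collision_prob H x' y))"
      by (simp add: emeasure_eq_measure flip: ennreal_mult) (intro ennreal_leI mult_left_mono; simp)
  qed
  finally show ?thesis .
qed

section \<open>Deterministic inequalities for squared weights and clipping\<close>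

text \<open>Here the choice of squared probabilities as weights pays off: once every minimum is
  replaced by \<open>D\<close>, the squares of \<open>p t / W\<close> add up to
  \<open>1 / W\<close>, and \<open>W\<close> contains the summand \<open>P\<^sup>2\<close> of index
  \<open>s\<close>.\<close>

lemma sum_square_weights_le:
  fixes p q :: "'t \<Rightarrow> real"
  assumes I: "finite I" and p: "\<And>t. t \<in> I \<Longrightarrow> 0 \<le> p t"
    and P: "0 < P" "s \<in> I" "p s = P"
    and D: "0 \<le> D" "\<And>t. t \<in> I \<Longrightarrow> min (p t) (q t) \<le> D"
  shows "(\<Sum>t\<in>I. (p t / (\<Sum>t\<in>I. (p t)\<^sup>2))\<^sup>2 * min (p t) (q t)) \<le> D / P\<^sup>2"
proof -
  define W where "W = (\<Sum>t\<in>I. (p t)\<^sup>2)"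
  have PW: "P\<^sup>2 \<le> W"
    unfolding W_def P(3)[symmetric] using I P(2) by (intro member_le_sum) auto
  then have W: "W > 0" using P(1) by (smt (verit) zero_less_power)
  have "(\<Sum>t\<in>I. (p t / W)\<^sup>2 * min (p t) (q t)) \<le> (\<Sum>t\<in>I. (p t / W)\<^sup>2 * D)"
    by (intro sum_mono mult_left_mono D) auto
  also have "\<dots> = D / W"
    using W by (simp add: power_divide W_def[symmetric] flip: sum_distrib_right sum_divide_distrib)
      (simp add: power2_eq_square)
  also have "\<dots> \<le> D / P\<^sup>2"
    using PW P(1) D(1) W by (intro divide_left_mono) auto
  finally show ?thesis unfolding W_def .
qed

text \<open>The reciprocal is the maximum of 1 and \<open>v / \<mu>\<close>, also at
  \<open>v = 0\<close>, and a maximum of nonnegative numbers is at most their sum. The sum is linear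
  in \<open>v\<close>, so it can be averaged over \<open>X\<close>.\<close>

lemma inverse_clip_ratio_le:
  assumes "0 < \<mu>" and "0 \<le> v"
  shows "0 < clip_ratio \<mu> v" and "1 / clip_ratio \<mu> v \<le> 1 + v / \<mu>"
  using assms by (auto simp: clip_ratio_def min_def field_simps)

text \<open>Symmetrising puts \<open>a x + a x'\<close> into the double sum, the form that
  \<open>G\<close> controls. Dividing by the positive clip factors leaves a product of two single
  sums, each at most twice the cardinality; the factor 4 is halved by the symmetrisation.\<close>

lemma double_sum_le_clip_ratio:
  fixes a :: "'x \<Rightarrow> real" and D :: "'x \<Rightarrow> 'x \<Rightarrow> real"
  assumes X: "finite X" and w: "\<And>x. 0 \<le> w x" and \<mu>: "0 < \<mu>" "(\<Sum>x\<in>X. w x) = real (card X) * \<mu>"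
    and sym: "\<And>x x'. D x x' = D x' x"
    and G: "\<And>x x'. x \<in> X \<Longrightarrow> x' \<in> X \<Longrightarrow>
      clip_ratio \<mu> (w x) * clip_ratio \<mu> (w x') * (a x + a x') * D x x' \<le> G"
    and G0: "0 \<le> G"
  shows "(\<Sum>x\<in>X. \<Sum>x'\<in>X. a x * D x x') \<le> (real (card X))\<^sup>2 * (2 * G)"
proof -
  let ?f = "\<lambda>x. clip_ratio \<mu> (w x)"
  note f = inverse_clip_ratio_le[OF \<mu>(1) w]
  have "(\<Sum>x\<in>X. \<Sum>x'\<in>X. a x * D x x') = (\<Sum>x\<in>X. \<Sum>x'\<in>X. a x' * D x x')"
    by (subst sum.swap) (simp add: sym)
  then have "2 * (\<Sum>x\<in>X. \<Sum>x'\<in>X. a x * D x x') = (\<Sum>x\<in>X. \<Sum>x'\<in>X. (a x + a x') * D x x')"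
    by (simp add: distrib_right sum.distrib)
  also have "\<dots> \<le> (\<Sum>x\<in>X. \<Sum>x'\<in>X. (1 / ?f x) * (1 / ?f x') * G)"
  proof (intro sum_mono)
    fix x x' assume x: "x \<in> X" "x' \<in> X"
    have "?f x > 0" "?f x' > 0" using f by auto
    then show "(a x + a x') * D x x' \<le> (1 / ?f x) * (1 / ?f x') * G"
      using G[OF x] by (simp add: field_simps)
  qed
  also have "\<dots> = (\<Sum>x\<in>X. 1 / ?f x)\<^sup>2 * G"
    unfolding power2_eq_square sum_product by (simp only: sum_distrib_right)
  also have "\<dots> \<le> (2 * real (card X))\<^sup>2 * G"
  proof (intro mult_right_mono power_mono G0)
    have "(\<Sum>x\<in>X. 1 / ?f x) \<le> (\<Sum>x\<in>X. 1 + w x / \<mu>)"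
      by (intro sum_mono f)
    \<comment> \<open>The values \<open>w x / \<mu>\<close> have average 1 over
      \<open>X\<close>.\<close>
    also have "\<dots> = 2 * real (card X)"
      using \<mu> by (simp add: sum.distrib flip: sum_divide_distrib)
    finally show "(\<Sum>x\<in>X. 1 / ?f x) \<le> 2 * real (card X)" .
    show "0 \<le> (\<Sum>x\<in>X. 1 / ?f x)"
      using f(1) by (intro sum_nonneg) (simp add: less_imp_le)
  qed
  finally show ?thesis by (simp add: power_mult_distrib mult_ac)
qed

section \<open>Elementary properties of collision probabilities and their extrema\<close>

lemma collision_prob_nonneg: "0 \<le> collision_prob H x y"
  by (simp add: collision_prob_def)

text \<open>Rounds without collisions add only zero squares.\<close>

lemma p2_total_eq: "p2_total T H x y = (\<Sum>t=1..T. (collision_prob (H t) x y)\<^sup>2)"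
  unfolding p2_total_def
  using collision_prob_nonneg[of _ x y]
  by (intro sum.mono_neutral_left) (auto simp: less_le)

text \<open>The supremum ranges over a finite nonempty set. A maximising round is what bounds the
  total of the squares from below by the square of \<open>p_star\<close>.\<close>

lemma p_star_attained:
  assumes "1 \<le> T"
  obtains s where "s \<in> {1..T}" "collision_prob (H s) x y = p_star T H x y"
proof -
  have "p_star T H x y = Max ((\<lambda>t. collision_prob (H t) x y) ` {1..T})"
    unfolding p_star_def using assms by (intro cSup_eq_Max) auto
  also have "\<dots> \<in> (\<lambda>t. collision_prob (H t) x y) ` {1..T}"
    using assms by (intro Max_in) auto
  finally show thesis using that by force
qed

lemma collision_prob_le_p_star:
  "t \<in> {1..T} \<Longrightarrow> collision_prob (H t) x y \<le> p_star T H x y"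
  unfolding p_star_def by (intro cSUP_upper) auto

lemma min_le_D_max:
  "t \<in> {1..T} \<Longrightarrow> min (collision_prob (H t) x1 y) (collision_prob (H t) x2 y) \<le> D_max T H y x1 x2"
  unfolding D_max_def by (intro Max_ge) auto

lemma D_max_commute: "D_max T H y x1 x2 = D_max T H y x2 x1"
  by (simp add: D_max_def min.commute)

lemma D_max_nonneg: "1 \<le> T \<Longrightarrow> 0 \<le> D_max T H y x1 x2"
  using min_le_D_max[of 1 T H x1 y x2] collision_prob_nonneg[of "H 1" x1 y]
    collision_prob_nonneg[of "H 1" x2 y] by auto

lemma D_max_le_p_star:
  assumes "1 \<le> T"
  shows "D_max T H y x1 x2 \<le> min (p_star T H x1 y) (p_star T H x2 y)"
  unfolding D_max_def using assms
  by (subst Max_le_iff) (auto simp: min_le_iff_disj intro: collision_prob_le_p_star)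

theorem theorem5:
  fixes X S :: "'x set" and T :: nat
    and H :: "nat \<Rightarrow> ('x, 'u) hash_pair measure"
    and w :: "'x \<Rightarrow> 'x \<Rightarrow> real" and ws :: "nat \<Rightarrow> 'x \<Rightarrow> 'x \<Rightarrow> real"
    and y :: 'x and \<mu> :: real
  assumes "X \<subseteq> S" and "finite X"
    and "\<And>u v. 0 \<le> w u v \<and> w u v \<le> 1"
    and "\<And>t. t \<in> {1..T} \<Longrightarrow> hashing_scheme (H t)"
    and "p2_weighted T H ws w"
    and "covers_support T H w"
    and "\<mu> = mean_weight X w y" and "\<mu> > 0"
  shows "(\<integral>\<^sup>+ \<omega>. ennreal ((mrhbe X T H ws y \<omega>)\<^sup>2) \<partial>mrhbe_space X T H y)
      \<le> ennreal (\<mu>\<^sup>2) + 4 * (SUP (x1, x2) \<in> S \<times> S.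
          (let f1 = clip_ratio \<mu> (w x1 y); f2 = clip_ratio \<mu> (w x2 y);
               p1 = p_star T H x1 y; p2 = p_star T H x2 y
           in ennreal (f1\<^sup>2 * ((w x1 y)\<^sup>2 / p1) + f2\<^sup>2 * ((w x2 y)\<^sup>2 / p2)
                + f1 * f2 * ((w x1 y)\<^sup>2 / p1\<^sup>2 + (w x2 y)\<^sup>2 / p2\<^sup>2) * D_max T H y x1 x2)))
    \<and> (\<forall>x1\<in>S. \<forall>x2\<in>S. D_max T H y x1 x2 \<le> min (p_star T H x1 y) (p_star T H x2 y))"
proof
  note XS = assms(1) and X = assms(2) and w = assms(3) and H = assms(4) and \<mu> = assms(7,8)
  let ?I = "{1..T}"
  define n where "n = real (card X)"
  define p where "p t x = collision_prob (H t) x y" for t x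
  define W where "W x = (\<Sum>t\<in>?I. (p t x)\<^sup>2)" for x
  define v where "v t x = ws t x y / p t x" for t x
  define P where "P x = p_star T H x y" for x
  define D where "D x x' = D_max T H y x x'" for x x'
  define f where "f x = clip_ratio \<mu> (w x y)" for x
  \<comment> \<open>For empty \<open>X\<close> the mean weight would be 0, because
    \<open>1 / 0 = 0\<close>.\<close>
  have n: "n > 0"
    using \<mu> by (cases "n = 0") (auto simp: n_def mean_weight_def)
  have sum_w: "(\<Sum>x\<in>X. w x y) = n * \<mu>"
    using n \<mu>(1) by (simp add: mean_weight_def n_def)
  have cov: "\<exists>t\<in>?I. p t x > 0" if "w x y \<noteq> 0" for x
    using assms(6) w[of x y] that unfolding covers_support_def p_def
    by (metis less_eq_real_def)
  \<comment> \<open>A positive mean forces a point of nonzero weight, and a round covering it shows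
    that the set of rounds is nonempty, so that the suprema and maxima over rounds are
    meaningful.\<close>
  have "\<exists>x\<in>X. w x y \<noteq> 0"
    using sum_w n \<mu>(2) by (metis mult_pos_pos less_irrefl sum.neutral)
  then have T: "1 \<le> T" using cov by fastforce
  show "\<forall>x1\<in>S. \<forall>x2\<in>S. D_max T H y x1 x2 \<le> min (p_star T H x1 y) (p_star T H x2 y)"
    by (intro ballI D_max_le_p_star T)

  \<comment> \<open>Weight identities and bounds at fixed points\<close>
  have p0: "0 \<le> p t x" for t x by (simp add: p_def collision_prob_nonneg)
  have W0: "0 \<le> W x" for x by (simp add: W_def sum_nonneg)
  \<comment> \<open>One of the two factors \<open>p t x\<close> in the weight cancels against the
    denominator of the estimator; for \<open>p t x = 0\<close> both sides are 0.\<close>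
  have v_eq: "v t x = p t x / W x * w x y" if "t \<in> ?I" for t x
    using assms(5) that unfolding p2_weighted_def p2_total_eq v_def
    by (simp add: p_def W_def power2_eq_square)
  have v0: "0 \<le> v t x" if "t \<in> ?I" for t x
    using p0 W0 w by (simp add: v_eq[OF that])
  have D0: "0 \<le> D x x'" for x x' using D_max_nonneg[OF T] by (simp add: D_def)
  have P_pos: "0 < P x" if "w x y \<noteq> 0" for x
    using cov[OF that] collision_prob_le_p_star[of _ T H x y]
    by (auto simp: P_def p_def intro: less_le_trans)
  have f0: "0 < f x" for x
    using inverse_clip_ratio_le(1)[OF \<mu>(2)] w by (simp add: f_def)

  \<comment> \<open>This is the unbiasedness of the estimator: the fractions
    \<open>(p t x)\<^sup>2 / W x\<close> sum to 1. A vanishing total \<open>W x\<close> can occur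
    only at weight 0.\<close>
  have first: "(\<Sum>t\<in>?I. v t x * p t x) = w x y" for x
  proof (cases "w x y = 0")
    case True
    then show ?thesis by (simp add: v_eq)
  next
    case False
    then obtain t where "t \<in> ?I" "p t x > 0" using cov by blast
    then have "W x > 0" unfolding W_def by (intro sum_pos2[of _ t]) auto
    have "(\<Sum>t\<in>?I. v t x * p t x) = (\<Sum>t\<in>?I. (p t x)\<^sup>2 * (w x y / W x))"
      by (intro sum.cong) (auto simp: v_eq power2_eq_square)
    also have "\<dots> = w x y"
      unfolding sum_distrib_right[symmetric] W_def[symmetric] using \<open>W x > 0\<close> by simp
    finally show ?thesis .
  qed

  \<comment> \<open>At weight 0 both sides vanish; otherwise \<open>P x\<close> is positive and is
    attained in some round.\<close>
  have second: "(\<Sum>t\<in>?I. (v t x)\<^sup>2 * min (p t x) (p t x')) \<le> (w x y)\<^sup>2 / (P x)\<^sup>2 * D x x'" for x x'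
  proof (cases "w x y = 0")
    case True
    then show ?thesis by (simp add: v_eq)
  next
    case False
    obtain s where s: "s \<in> ?I" "p s x = P x"
      using p_star_attained[OF T] unfolding p_def P_def by metis
    have "(\<Sum>t\<in>?I. (p t x / W x)\<^sup>2 * min (p t x) (p t x')) \<le> D x x' / (P x)\<^sup>2"
      unfolding W_def
      using s p0 P_pos[OF False] D0 min_le_D_max[of _ T H x y x']
      by (intro sum_square_weights_le) (auto simp: p_def D_def)
    then have "(w x y)\<^sup>2 * (\<Sum>t\<in>?I. (p t x / W x)\<^sup>2 * min (p t x) (p t x'))
        \<le> (w x y)\<^sup>2 * (D x x' / (P x)\<^sup>2)"
      by (intro mult_left_mono) auto
    moreover have "(\<Sum>t\<in>?I. (v t x)\<^sup>2 * min (p t x) (p t x'))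
        = (w x y)\<^sup>2 * (\<Sum>t\<in>?I. (p t x / W x)\<^sup>2 * min (p t x) (p t x'))"
      unfolding sum_distrib_left by (intro sum.cong) (simp_all add: v_eq power_mult_distrib power_divide)
    ultimately show ?thesis by simp
  qed

  \<comment> \<open>Comparison with the expression under the supremum\<close>
  define G where "G x1 x2 = (f x1)\<^sup>2 * ((w x1 y)\<^sup>2 / P x1) + (f x2)\<^sup>2 * ((w x2 y)\<^sup>2 / P x2)
      + f x1 * f x2 * ((w x1 y)\<^sup>2 / (P x1)\<^sup>2 + (w x2 y)\<^sup>2 / (P x2)\<^sup>2) * D x1 x2" for x1 x2
  have diag: "0 \<le> (f x)\<^sup>2 * ((w x y)\<^sup>2 / P x)" for x
    using P_pos[of x] by (cases "w x y = 0") auto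
  \<comment> \<open>The two diagonal terms are nonnegative, so the mixed term alone stays below
    \<open>G\<close>.\<close>
  have G_ge: "f x * f x' * ((w x y)\<^sup>2 / (P x)\<^sup>2 + (w x' y)\<^sup>2 / (P x')\<^sup>2) * D x x' \<le> G x x'" for x x'
    using diag[of x] diag[of x'] by (simp add: G_def)
  have G0: "0 \<le> G x x'" for x x'
    using f0[of x] f0[of x'] D0[of x x'] by (intro order_trans[OF _ G_ge]) simp
  \<comment> \<open>A maximum over the finite set \<open>X \<times> X\<close> keeps the estimates in
    the reals, whereas the supremum over \<open>S \<times> S\<close> may be infinite. Being a value
    of \<open>G\<close>, \<open>m\<close> lies below that supremum.\<close>
  define m where "m = Max ((\<lambda>(x, x'). G x x') ` (X \<times> X))"
  have X_ne: "X \<noteq> {}" using n by (auto simp: n_def)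
  have m_in: "m \<in> (\<lambda>(x, x'). G x x') ` (X \<times> X)"
    unfolding m_def using X X_ne by (intro Max_in) auto
  have G_le_m: "G x x' \<le> m" if "x \<in> X" "x' \<in> X" for x x'
    unfolding m_def using X that by (intro Max_ge) auto
  have m0: "0 \<le> m" using m_in G0 by auto

  have sum_D: "(\<Sum>x\<in>X. \<Sum>x'\<in>X. (w x y)\<^sup>2 / (P x)\<^sup>2 * D x x') \<le> n\<^sup>2 * (2 * m)"
    unfolding n_def
  proof (rule double_sum_le_clip_ratio[where w = "\<lambda>x. w x y" and \<mu> = \<mu>])
    show "D x x' = D x' x" for x x' unfolding D_def by (rule D_max_commute)
    show "clip_ratio \<mu> (w x y) * clip_ratio \<mu> (w x' y)
        * ((w x y)\<^sup>2 / (P x)\<^sup>2 + (w x' y)\<^sup>2 / (P x')\<^sup>2) * D x x' \<le> m" if "x \<in> X" "x' \<in> X" for x x'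
      using order_trans[OF G_ge G_le_m[OF that]] by (simp add: f_def)
  qed (use X w \<mu> sum_w m0 in \<open>auto simp: n_def\<close>)

  \<comment> \<open>From rounds to the second moment of the estimator\<close>
  let ?M = "\<lambda>t. bucket_sample X y (H t)" and ?Y = "\<lambda>t. bucket_term X y (v t)"
  have Y0: "0 \<le> ?Y t q" if "t \<in> ?I"
    for t and q :: "('x, 'u) hash_pair \<times> 'x option"
    using v0[OF that] by (auto simp: bucket_term_def split: option.split)
  have Y_meas: "(\<lambda>q. ennreal (?Y t q)) \<in> borel_measurable (?M t)" if "t \<in> ?I" for t
    unfolding measurable_cong_sets[OF sets_bucket_sample[OF H[OF that] X] refl]
    by (intro measurable_compose[OF borel_measurable_bucket_term measurable_ennreal] H that X)
  have square: "ennreal ((mrhbe X T H ws y \<omega>)\<^sup>2) = ennreal (1 / n\<^sup>2) * (\<Sum>t\<in>?I. ennreal (?Y t (\<omega> t)))\<^sup>2"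
    for \<omega>
  proof -
    have "mrhbe X T H ws y \<omega> = 1 / n * (\<Sum>t\<in>?I. ?Y t (\<omega> t))"
      unfolding mrhbe_def bucket_term_def n_def v_def p_def ..
    then have "(mrhbe X T H ws y \<omega>)\<^sup>2 = 1 / n\<^sup>2 * (\<Sum>t\<in>?I. ?Y t (\<omega> t))\<^sup>2"
      by (simp add: power_divide)
    also have "ennreal \<dots> = ennreal (1 / n\<^sup>2) * (ennreal (\<Sum>t\<in>?I. ?Y t (\<omega> t)))\<^sup>2"
      by (subst ennreal_power, intro sum_nonneg Y0) (auto simp flip: ennreal_mult)
    also have "ennreal (\<Sum>t\<in>?I. ?Y t (\<omega> t)) = (\<Sum>t\<in>?I. ennreal (?Y t (\<omega> t)))"
      by (intro sum_ennreal[symmetric] Y0)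
    finally show ?thesis .
  qed
  have prob: "prob_space (?M t)" if "t \<in> ?I" for t
    by (rule prob_space_bucket_sample[OF H[OF that] X])
  have "(\<integral>\<^sup>+ \<omega>. (\<Sum>t\<in>?I. ennreal (?Y t (\<omega> t)))\<^sup>2 \<partial>PiM ?I ?M)
      \<le> (\<Sum>t\<in>?I. \<integral>\<^sup>+q. ennreal (?Y t q) \<partial>?M t)\<^sup>2 + (\<Sum>t\<in>?I. \<integral>\<^sup>+q. (ennreal (?Y t q))\<^sup>2 \<partial>?M t)"
    by (intro nn_integral_PiM_sum_square_le prob Y_meas) auto
  also have "\<dots> \<le> (\<Sum>t\<in>?I. \<Sum>x\<in>X. ennreal (v t x * p t x))\<^sup>2
      + (\<Sum>t\<in>?I. \<Sum>x\<in>X. \<Sum>x'\<in>X. ennreal ((v t x)\<^sup>2 * min (p t x) (p t x')))"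
    unfolding p_def
    by (intro add_mono power_mono sum_mono order_eq_refl[OF nn_integral_bucket_term]
        nn_integral_bucket_term_square_le H X v0) auto
  also have "\<dots> = ennreal ((\<Sum>t\<in>?I. \<Sum>x\<in>X. v t x * p t x)\<^sup>2
      + (\<Sum>t\<in>?I. \<Sum>x\<in>X. \<Sum>x'\<in>X. (v t x)\<^sup>2 * min (p t x) (p t x')))"
  proof -
    have "(\<Sum>t\<in>?I. \<Sum>x\<in>X. ennreal (v t x * p t x)) = (\<Sum>t\<in>?I. ennreal (\<Sum>x\<in>X. v t x * p t x))"
      by (intro sum.cong sum_ennreal refl mult_nonneg_nonneg v0 p0)
    also have "\<dots> = ennreal (\<Sum>t\<in>?I. \<Sum>x\<in>X. v t x * p t x)"
      by (intro sum_ennreal sum_nonneg mult_nonneg_nonneg v0 p0)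
    finally have "(\<Sum>t\<in>?I. \<Sum>x\<in>X. ennreal (v t x * p t x))\<^sup>2
        = ennreal ((\<Sum>t\<in>?I. \<Sum>x\<in>X. v t x * p t x)\<^sup>2)"
      by (simp only:) (intro ennreal_power sum_nonneg mult_nonneg_nonneg v0 p0)
    then show ?thesis by (simp add: sum_ennreal sum_nonneg p0)
  qed
  also have "\<dots> \<le> ennreal (n\<^sup>2 * \<mu>\<^sup>2 + n\<^sup>2 * (2 * m))"
  proof (intro ennreal_leI add_mono)
    \<comment> \<open>Summing over the rounds first turns each point into its weight, and the
      weights add up to \<open>n * \<mu>\<close>.\<close>
    have "(\<Sum>t\<in>?I. \<Sum>x\<in>X. v t x * p t x) = n * \<mu>"
      unfolding sum.swap[of _ X] first sum_w ..
    then show "(\<Sum>t\<in>?I. \<Sum>x\<in>X. v t x * p t x)\<^sup>2 \<le> n\<^sup>2 * \<mu>\<^sup>2"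
      by (simp add: power_mult_distrib)
    have "(\<Sum>t\<in>?I. \<Sum>x\<in>X. \<Sum>x'\<in>X. (v t x)\<^sup>2 * min (p t x) (p t x'))
        = (\<Sum>x\<in>X. \<Sum>x'\<in>X. \<Sum>t\<in>?I. (v t x)\<^sup>2 * min (p t x) (p t x'))"
      by (subst sum.swap) (intro sum.cong refl sum.swap)
    also have "\<dots> \<le> (\<Sum>x\<in>X. \<Sum>x'\<in>X. (w x y)\<^sup>2 / (P x)\<^sup>2 * D x x')"
      by (intro sum_mono second)
    finally show "(\<Sum>t\<in>?I. \<Sum>x\<in>X. \<Sum>x'\<in>X. (v t x)\<^sup>2 * min (p t x) (p t x')) \<le> n\<^sup>2 * (2 * m)"
      using sum_D by linarith
  qed
  finally have bound: "(\<integral>\<^sup>+ \<omega>. (\<Sum>t\<in>?I. ennreal (?Y t (\<omega> t)))\<^sup>2 \<partial>PiM ?I ?M)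
      \<le> ennreal (n\<^sup>2 * \<mu>\<^sup>2 + n\<^sup>2 * (2 * m))" .
  have "(\<lambda>\<omega>. \<Sum>t\<in>?I. ennreal (?Y t (\<omega> t))) \<in> borel_measurable (PiM ?I ?M)"
    by (intro borel_measurable_sum measurable_compose[OF _ Y_meas] measurable_component_singleton)
  then have "(\<integral>\<^sup>+ \<omega>. ennreal ((mrhbe X T H ws y \<omega>)\<^sup>2) \<partial>mrhbe_space X T H y)
      = ennreal (1 / n\<^sup>2) * (\<integral>\<^sup>+ \<omega>. (\<Sum>t\<in>?I. ennreal (?Y t (\<omega> t)))\<^sup>2 \<partial>PiM ?I ?M)"
    unfolding square mrhbe_space_def by (intro nn_integral_cmult borel_measurable_power_ennreal)
  also have "\<dots> \<le> ennreal (1 / n\<^sup>2) * ennreal (n\<^sup>2 * \<mu>\<^sup>2 + n\<^sup>2 * (2 * m))"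
    by (intro mult_left_mono bound) simp
  also have "\<dots> = ennreal (\<mu>\<^sup>2 + 2 * m)"
    using n by (simp add: ennreal_mult'[symmetric] add_divide_distrib)
  \<comment> \<open>The symmetrised double sum gives the constant 2, which is relaxed to 4 using
    \<open>m0\<close>.\<close>
  also have "\<dots> \<le> ennreal (\<mu>\<^sup>2 + 4 * m)"
    using m0 by (intro ennreal_leI) simp
  also have "\<dots> = ennreal (\<mu>\<^sup>2) + 4 * ennreal m"
    using m0 by (simp add: ennreal_plus ennreal_mult)
  also have "ennreal m \<le> (SUP (x1, x2) \<in> S \<times> S. ennreal (G x1 x2))"
  proof -
    obtain x1 x2 where "x1 \<in> X" "x2 \<in> X" "m = G x1 x2" using m_in by auto
    then show ?thesis using XS by (intro SUP_upper2[of "(x1, x2)"]) auto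
  qed
  finally show "(\<integral>\<^sup>+ \<omega>. ennreal ((mrhbe X T H ws y \<omega>)\<^sup>2) \<partial>mrhbe_space X T H y)
      \<le> ennreal (\<mu>\<^sup>2) + 4 * (SUP (x1, x2) \<in> S \<times> S.
          (let f1 = clip_ratio \<mu> (w x1 y); f2 = clip_ratio \<mu> (w x2 y);
               p1 = p_star T H x1 y; p2 = p_star T H x2 y
           in ennreal (f1\<^sup>2 * ((w x1 y)\<^sup>2 / p1) + f2\<^sup>2 * ((w x2 y)\<^sup>2 / p2)
                + f1 * f2 * ((w x1 y)\<^sup>2 / p1\<^sup>2 + (w x2 y)\<^sup>2 / p2\<^sup>2) * D_max T H y x1 x2)))"
    unfolding Let_def G_def f_def P_def D_def
    by (simp add: add_left_mono mult_left_mono)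
qed

end
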